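(* Let $X$ be a complex Banach space, let $T\in\mathcal B(X)$, and let $\{V_j:j\in\mathbb N\}$ be a countable basis of nonempty open subsets of $\mathbb C$. The following assertions are equivalent: (i) $T$ is topologically numerically transitive; (ii) for every $j\in\mathbb N$, the set $\bigcup_{n\ge 0}F_n^{-1}(V_j)$ is open and dense in $\Pi(X)$; (iii) $\mathcal U(T)$ is a dense $G_\delta$ subset of $\Pi(X)$.
   Context: $\mathcal B(X)$ denotes the bounded linear operators on $X$; $S_X$ and $S_{X^*}$ are the unit spheres of $X$ and its dual $X^*$. The state space is $\Pi(X):=\{(x,x^* )\in S_X\times S_{X^*}: x^*(x)=1\}$, with the topology induced by the norm $\|(x,x^* )\|_\times=\max\{\|x\|,\|x^*\|\}$ on $X\times X^*$. For $T\in\mathcal B(X)$ and $n\in\mathbb N_0=\{0,1,2,\dots\}$, $F_n:\Pi(X)\to\mathbb C$ is $F_n(x,x^* )=x^*(T^nx)$. $T$ is topologically numerically transitive if for every nonempty open $U\subset\Pi(X)$ and nonempty open $V\subset\mathbb C$ there is $n\in\mathbb N_0$ with $F_n(U)\cap V\ne\varnothing$. $\mathcal U(T)$ is the set of all $(x,x^* )\in\Pi(X)$ such that $\{x^*(T^nx):n\ge 0\}$ is dense in $\mathbb C$. *)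

theory Defs
  imports "HOL-Analysis.Analysis"
begin

class scaleC =
  fixes scaleC :: "complex \<Rightarrow> 'a \<Rightarrow> 'a" (infixr "*\<^sub>C" 75)

(* A complex normed space is a real normed space whose scalar multiplication and
   norm homogeneity extend to complex scalars. *)
class complex_normed_vector = real_normed_vector + scaleC +
  assumes scaleC_add_right: "a *\<^sub>C (x + y) = a *\<^sub>C x + a *\<^sub>C y"
    and scaleC_add_left: "(a + b) *\<^sub>C x = a *\<^sub>C x + b *\<^sub>C x"
    and scaleC_scaleC: "a *\<^sub>C (b *\<^sub>C x) = (a * b) *\<^sub>C x"
    and scaleC_of_real: "complex_of_real r *\<^sub>C x = r *\<^sub>R x"
    and norm_scaleC: "norm (a *\<^sub>C x) = cmod a * norm x"

class complex_banach = complex_normed_vector + banach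

instantiation complex :: complex_banach
begin

definition scaleC_complex :: "complex \<Rightarrow> complex \<Rightarrow> complex"
  where "scaleC_complex a x = a * x"

instance
  by standard (auto simp: scaleC_complex_def algebra_simps norm_mult scaleR_conv_of_real)

end

(* The library type of bounded operators consists of the real-linear ones. Its norm is the
   supremum of norm (f x) / norm x, which on the complex-linear operators
   is the usual operator norm; for functionals, the dual norm. *)
definition bounded_clinear_ops ::
    "('a::complex_normed_vector \<Rightarrow>\<^sub>L 'b::complex_normed_vector) set"
  where "bounded_clinear_ops =
    {f. \<forall>c x. blinfun_apply f (c *\<^sub>C x) = c *\<^sub>C blinfun_apply f x}"

definition dual_space :: "('a::complex_normed_vector \<Rightarrow>\<^sub>L complex) set"
  where "dual_space = bounded_clinear_ops"

definition state_space :: "('a::complex_normed_vector \<times> ('a \<Rightarrow>\<^sub>L complex)) set"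
  where "state_space =
    {(x, f). norm x = 1 \<and> f \<in> dual_space \<and> norm f = 1 \<and> blinfun_apply f x = 1}"

(* The library norm on products is Euclidean, so the max-norm distance is written out. *)
definition max_dist ::
    "'a::complex_normed_vector \<times> ('a \<Rightarrow>\<^sub>L complex) \<Rightarrow> 'a \<times> ('a \<Rightarrow>\<^sub>L complex) \<Rightarrow> real"
  where "max_dist p q = max (norm (fst p - fst q)) (norm (snd p - snd q))"

definition state_topology ::
    "('a::complex_normed_vector \<times> ('a \<Rightarrow>\<^sub>L complex)) topology"
  where "state_topology = Metric_space.mtopology state_space max_dist"

definition num_orbit ::
    "('a::complex_normed_vector \<Rightarrow>\<^sub>L 'a) \<Rightarrow> nat \<Rightarrow> 'a \<times> ('a \<Rightarrow>\<^sub>L complex) \<Rightarrow> complex"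
  where "num_orbit T n = (\<lambda>(x, f). blinfun_apply f ((blinfun_apply T ^^ n) x))"

definition top_num_transitive :: "('a::complex_normed_vector \<Rightarrow>\<^sub>L 'a) \<Rightarrow> bool"
  where "top_num_transitive T \<longleftrightarrow>
    (\<forall>U V. openin state_topology U \<and> U \<noteq> {} \<and> open V \<and> V \<noteq> {} \<longrightarrow>
      (\<exists>n. num_orbit T n ` U \<inter> V \<noteq> {}))"

definition num_universal ::
    "('a::complex_normed_vector \<Rightarrow>\<^sub>L 'a) \<Rightarrow> ('a \<times> ('a \<Rightarrow>\<^sub>L complex)) set"
  where "num_universal T =
    {p \<in> state_space. closure {num_orbit T n p | n. True} = UNIV}"

lemma Metric_space_state_space: "Metric_space state_space max_dist"
proof
  fix p q r :: "'a \<times> ('a \<Rightarrow>\<^sub>L complex)"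
  show "0 \<le> max_dist p q" by (auto simp: max_dist_def le_max_iff_disj)
  show "max_dist p q = max_dist q p" by (simp add: max_dist_def norm_minus_commute)
  show "(max_dist p q = 0) = (p = q)"
  proof
    assume "max_dist p q = 0"
    then have "norm (fst p - fst q) \<le> 0" "norm (snd p - snd q) \<le> 0"
      unfolding max_dist_def by linarith+
    then show "p = q" by (simp add: prod_eq_iff)
  qed (simp add: max_dist_def)
  have "norm (fst p - fst r) \<le> norm (fst p - fst q) + norm (fst q - fst r)"
    "norm (snd p - snd r) \<le> norm (snd p - snd q) + norm (snd q - snd r)"
    using norm_triangle_ineq[of "fst p - fst q" "fst q - fst r"]
      norm_triangle_ineq[of "snd p - snd q" "snd q - snd r"] by simp_all
  then show "max_dist p r \<le> max_dist p q + max_dist q r"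
    unfolding max_dist_def by linarith
qed

lemma topspace_state_topology [simp]: "topspace state_topology = state_space"
  unfolding state_topology_def
  by (rule Metric_space.topspace_mtopology[OF Metric_space_state_space])

lemma state_topology_eq_top_of_set: "state_topology = top_of_set state_space"
proof -
  interpret A: Metric_space "state_space :: ('a \<times> ('a \<Rightarrow>\<^sub>L complex)) set" max_dist
    by (rule Metric_space_state_space)
  have le: "max_dist p q \<le> dist p q" "dist p q \<le> 2 * max_dist p q"
    for p q :: "'a \<times> ('a \<Rightarrow>\<^sub>L complex)"
  proof -
    show "max_dist p q \<le> dist p q"
      using dist_fst_le[of p q] dist_snd_le[of p q] by (simp add: max_dist_def dist_norm)
    have "dist p q \<le> dist (fst p) (fst q) + dist (snd p) (snd q)"
      unfolding dist_prod_def by (rule sqrt_sum_squares_le_sum) auto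
    then show "dist p q \<le> 2 * max_dist p q"
      unfolding max_dist_def dist_norm by linarith
  qed
  show ?thesis
    unfolding topology_eq state_topology_def
  proof
    fix U :: "('a \<times> ('a \<Rightarrow>\<^sub>L complex)) set"
    show "openin A.mtopology U = openin (top_of_set state_space) U"
    proof
      assume L: "openin A.mtopology U"
      show "openin (top_of_set state_space) U"
        unfolding openin_euclidean_subtopology_iff
      proof (intro conjI ballI)
        show "U \<subseteq> state_space" using L A.openin_mtopology by blast
        fix x assume "x \<in> U"
        then obtain e where e: "e > 0" "A.mball x e \<subseteq> U" "x \<in> state_space"
          using L A.openin_mtopology by blast
        have "y \<in> U" if "y \<in> state_space" "dist y x < e" for y
        proof -
          have "y \<in> A.mball x e"
            using le(1)[of x y] that e(3) by (simp add: dist_commute)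
          then show ?thesis using e(2) by blast
        qed
        then show "\<exists>e>0. \<forall>x'\<in>state_space. dist x' x < e \<longrightarrow> x' \<in> U"
          using e(1) by blast
      qed
    next
      assume R: "openin (top_of_set state_space) U"
      show "openin A.mtopology U"
        unfolding A.openin_mtopology
      proof (intro conjI allI impI)
        show "U \<subseteq> state_space" using R openin_euclidean_subtopology_iff by blast
        fix x assume "x \<in> U"
        then obtain e where e: "e > 0" "\<And>y. y \<in> state_space \<Longrightarrow> dist y x < e \<Longrightarrow> y \<in> U"
          using R unfolding openin_euclidean_subtopology_iff by blast
        have "A.mball x (e/2) \<subseteq> U"
        proof
          fix y assume "y \<in> A.mball x (e/2)"
          then show "y \<in> U" using le(2)[of x y] by (intro e(2)) (auto simp: dist_commute)
        qed
        then show "\<exists>r>0. A.mball x r \<subseteq> U" using e(1) half_gt_zero by blast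
      qed
    qed
  qed
qed

end

theory Submission
  imports Defs
begin

text \<open>Openness of the sets in (ii) is automatic because every \<open>F\<^sub>n\<close> is continuous, and
  their density is transitivity tested on basic open sets.
  The set \<open>\<U>(T)\<close> is the intersection over \<open>j\<close> of the sets in (ii). The state space is closed in
  the Banach space \<open>X \<times> X\<^sup>*\<close>, so the Baire category theorem makes this intersection
  dense. Conversely, a dense \<open>\<U>(T)\<close> meets every nonempty open \<open>U\<close>, and a universal pair in \<open>U\<close>
  visits every nonempty open subset of the plane.\<close>

text \<open>Every defining condition is an equation between continuous functions of the pair;
  complex linearity is a family of such equations, one for each fixed \<open>c\<close> and
  \<open>x\<close>.\<close>

lemma closed_state_space:
  "closed (state_space :: ('a::complex_normed_vector \<times> ('a \<Rightarrow>\<^sub>L complex)) set)"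
proof -
  have eq: "(state_space :: ('a \<times> ('a \<Rightarrow>\<^sub>L complex)) set) =
      {p. norm (fst p) = 1 \<and> norm (snd p) = 1 \<and> blinfun_apply (snd p) (fst p) = 1 \<and>
          (\<forall>c x. blinfun_apply (snd p) (c *\<^sub>C x) = c *\<^sub>C blinfun_apply (snd p) x)}"
    by (auto simp: state_space_def dual_space_def bounded_clinear_ops_def)
  show ?thesis
    \<comment> \<open>Scaling in the codomain becomes ordinary multiplication, whose continuity is
      known; \<open>c *\<^sub>C x\<close> in the domain is constant in \<open>p\<close>.\<close>
    unfolding eq scaleC_complex_def
    by (intro closed_Collect_conj closed_Collect_all closed_Collect_eq continuous_intros)
qed

text \<open>This supplies the hypothesis of the Baire theorem, and it is here that completeness of
  the underlying space enters.\<close>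

lemma completely_metrizable_state_topology:
  "completely_metrizable_space
     (state_topology :: ('a::complex_banach \<times> ('a \<Rightarrow>\<^sub>L complex)) topology)"
  unfolding state_topology_eq_top_of_set
  by (intro completely_metrizable_space_closedin completely_metrizable_space_euclidean)
     (simp add: closed_state_space)

text \<open>Evaluation of a bounded operator at a vector is jointly continuous, and powers of
  \<open>T\<close> are continuous, so each \<open>num_orbit T n\<close> is continuous on
  pairs.\<close>

lemma openin_num_orbit_vimage:
  fixes T :: "'a::complex_normed_vector \<Rightarrow>\<^sub>L 'a"
  assumes "open W"
  shows "openin state_topology (\<Union>n. num_orbit T n -` W \<inter> state_space)"
proof -
  have pow: "continuous_on UNIV (blinfun_apply T ^^ n)" for n
  proof (induction n)
    case (Suc n)
    then show ?case
      by (auto simp: o_def intro: continuous_intros)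
  qed (simp add: id_def continuous_on_id)
  have "continuous_on state_space (num_orbit T n)" for n
    unfolding num_orbit_def case_prod_beta
    by (intro continuous_intros continuous_on_compose2[OF pow]) auto
  then show ?thesis
    unfolding state_topology_eq_top_of_set
    using continuous_openin_preimage_gen[OF _ assms] by (intro openin_Union) (auto simp: Int_commute)
qed

lemma dense_iff_meets_basis:
  assumes "topological_basis (range V)" "\<And>j. V j \<noteq> {}"
  shows "closure S = UNIV \<longleftrightarrow> (\<forall>j. S \<inter> V j \<noteq> {})"
proof
  assume "closure S = UNIV"
  then show "\<forall>j. S \<inter> V j \<noteq> {}"
    using open_Int_closure_eq_empty[of "V _" S] topological_basis_open[OF assms(1)] assms(2)
    by (metis Int_UNIV_right Int_commute rangeI)
next
  assume meets: "\<forall>j. S \<inter> V j \<noteq> {}"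
  have "x \<in> closure S" for x
  proof (rule ccontr)
    assume "x \<notin> closure S"
    then obtain j where "V j \<subseteq> - closure S"
      using topological_basisE[OF assms(1), of "- closure S" x] by auto
    then show False
      using meets closure_subset[of S] by blast
  qed
  then show "closure S = UNIV"
    by blast
qed

lemma num_universal_eq_Inter:
  assumes "topological_basis (range V)" "\<And>j. V j \<noteq> {}"
  shows "num_universal T = (\<Inter>j. \<Union>n. num_orbit T n -` V j \<inter> state_space)"
  unfolding num_universal_def dense_iff_meets_basis[OF assms] by blast

theorem proposition3p3:
  fixes T :: "'a::complex_banach \<Rightarrow>\<^sub>L 'a"
    and V :: "nat \<Rightarrow> complex set"
  assumes "T \<in> bounded_clinear_ops"
    and "topological_basis (range V)"
    and "\<And>j. V j \<noteq> {}"
  shows "(top_num_transitive T \<longleftrightarrow>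
            (\<forall>j. openin state_topology (\<Union>n. num_orbit T n -` V j \<inter> state_space) \<and>
                 state_topology closure_of (\<Union>n. num_orbit T n -` V j \<inter> state_space) = state_space)) \<and>
         (top_num_transitive T \<longleftrightarrow>
            gdelta_in state_topology (num_universal T) \<and>
            state_topology closure_of (num_universal T) = state_space)"
proof -
  let ?A = "\<lambda>j. \<Union>n. num_orbit T n -` V j \<inter> state_space"
  note universal = num_universal_eq_Inter[OF assms(2,3), of T]
  have V: "open (V j)" for j
    using topological_basis_open[OF assms(2)] by simp
  have opn: "openin state_topology (?A j)" for j
    by (rule openin_num_orbit_vimage[OF V])
  \<comment> \<open>This holds for every \<open>T\<close>, so only the density in (iii) carries
    information.\<close>
  have gdelta: "gdelta_in state_topology (num_universal T)"
    unfolding universal by (rule gdelta_in_Inter) (use opn open_imp_gdelta_in in blast)+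
  have i_ii: "state_topology closure_of ?A j = state_space" if trans: "top_num_transitive T" for j
  proof -
    have "?A j \<inter> U \<noteq> {}" if U: "openin state_topology U" "U \<noteq> {}" for U
    proof -
      obtain n where "num_orbit T n ` U \<inter> V j \<noteq> {}"
        using trans U V assms(3) unfolding top_num_transitive_def by meson
      then show ?thesis
        \<comment> \<open>Open sets of the topology lie in \<open>state_space\<close>, so the point
          found in \<open>U\<close> belongs to \<open>?A j\<close>.\<close>
        using openin_subset[OF U(1)] by auto
    qed
    then show ?thesis
      using dense_intersects_open[of state_topology "?A j"] by simp
  qed
  have ii_iii: "state_topology closure_of (num_universal T) = state_space"
    if "\<And>j. state_topology closure_of ?A j = state_space"
  proof -
    \<comment> \<open>Baire applies because the family is indexed by the naturals, hence
      countable.\<close>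
    have "state_topology closure_of \<Inter>(range ?A) = topspace state_topology"
    proof (rule Baire_category)
      fix S assume "S \<in> range ?A"
      then obtain j where "S = ?A j"
        by (rule rangeE)
      then show "openin state_topology S \<and> state_topology closure_of S = topspace state_topology"
        using opn that by (simp only: topspace_state_topology)
    qed (simp_all add: completely_metrizable_state_topology)
    then show ?thesis
      by (simp only: universal topspace_state_topology)
  qed
  have iii_i: "top_num_transitive T"
    if dense: "state_topology closure_of (num_universal T) = state_space"
    unfolding top_num_transitive_def
  proof (intro allI impI, elim conjE)
    fix U :: "('a \<times> ('a \<Rightarrow>\<^sub>L complex)) set" and W :: "complex set"
    assume U: "openin state_topology U" "U \<noteq> {}" and W: "open W" "W \<noteq> {}"
    \<comment> \<open>The choice of \<open>p\<close> depends on \<open>U\<close> alone; its dense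
      orbit then meets any \<open>W\<close>.\<close>
    obtain p where p: "p \<in> num_universal T" "p \<in> U"
      using dense U dense_intersects_open[of state_topology "num_universal T"]
      unfolding topspace_state_topology by blast
    then have "closure {num_orbit T n p | n. True} = UNIV"
      by (simp add: num_universal_def)
    then have "W \<inter> {num_orbit T n p | n. True} \<noteq> {}"
      using open_Int_closure_eq_empty[OF W(1)] W(2) by (metis Int_UNIV_right)
    then show "\<exists>n. num_orbit T n ` U \<inter> W \<noteq> {}"
      using p(2) by blast
  qed
  show ?thesis
    using opn gdelta i_ii ii_iii iii_i by blast
qed

end
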